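(* Let $R$ be a commutative ring with unity, $I$ a proper ideal of $R$, $a,b\in R$, and let $Q$ be the total ring of fractions of $R(I)_{a,b}$. Then each element of $Q$ is of the form $\frac{r+it}{u}$, with $r\in R$, $i\in I$, and $u$ a regular element of $R$.
   Context: The Rees algebra of $R$ with respect to $I$ is $\mathcal R_+=\bigoplus_{n\ge 0} I^nt^n\subseteq R[t]$. For $a,b\in R$, let $(I^2(t^2+at+b))$ denote the ideal $(t^2+at+b)R[t]\cap \mathcal R_+$ of $\mathcal R_+$, and set $R(I)_{a,b}=\mathcal R_+/(I^2(t^2+at+b))$. Each element of $R(I)_{a,b}$ is uniquely represented by a polynomial $r+it$ with $r\in R$, $i\in I$, and is denoted simply $r+it$; $R$ is a subring of $R(I)_{a,b}$. A regular element is a non-zero-divisor. *)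

theory Defs
  imports "HOL-Algebra.UnivPoly" "HOL-Algebra.QuotRing" "HOL-Algebra.Ideal_Product"
begin

section \<open>The total ring of fractions\<close>

definition regular_elements :: "('a, 'm) ring_scheme \<Rightarrow> 'a set" where
  "regular_elements S =
     {s \<in> carrier S. \<forall>x \<in> carrier S. s \<otimes>\<^bsub>S\<^esub> x = \<zero>\<^bsub>S\<^esub> \<longrightarrow> x = \<zero>\<^bsub>S\<^esub>}"

text \<open>The fraction \<open>x/s\<close> is the class of \<open>(x, s)\<close> under
  \<open>(x, s) \<sim> (y, v) \<longleftrightarrow> x v = y s\<close>. No extra multiplier is needed, since all denominators
  are regular. The definition is meaningful only for regular \<open>s\<close>.\<close>

definition fraction :: "('a, 'm) ring_scheme \<Rightarrow> 'a \<Rightarrow> 'a \<Rightarrow> ('a \<times> 'a) set" where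
  "fraction S x s =
     {(y, v). y \<in> carrier S \<and> v \<in> regular_elements S \<and> x \<otimes>\<^bsub>S\<^esub> v = y \<otimes>\<^bsub>S\<^esub> s}"

text \<open>As for \<^const>\<open>rcoset_mult\<close>, the operations are unions over all representatives; the
  lemmas \<open>fraction_mult\<close> and \<open>fraction_add\<close> below show that each union consists of
  a single class.\<close>

definition total_fraction_ring :: "('a, 'm) ring_scheme \<Rightarrow> (('a \<times> 'a) set) ring" where
  "total_fraction_ring S =
     \<lparr>carrier = {fraction S x s | x s. x \<in> carrier S \<and> s \<in> regular_elements S},
      mult = (\<lambda>A B. \<Union>(x, s)\<in>A. \<Union>(y, v)\<in>B. fraction S (x \<otimes>\<^bsub>S\<^esub> y) (s \<otimes>\<^bsub>S\<^esub> v)),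
      one = fraction S \<one>\<^bsub>S\<^esub> \<one>\<^bsub>S\<^esub>,
      zero = fraction S \<zero>\<^bsub>S\<^esub> \<one>\<^bsub>S\<^esub>,
      add = (\<lambda>A B. \<Union>(x, s)\<in>A. \<Union>(y, v)\<in>B.
               fraction S (x \<otimes>\<^bsub>S\<^esub> v \<oplus>\<^bsub>S\<^esub> y \<otimes>\<^bsub>S\<^esub> s) (s \<otimes>\<^bsub>S\<^esub> v))\<rparr>"

context cring
begin

lemma regularD: "s \<in> regular_elements R \<Longrightarrow> s \<in> carrier R"
  by (simp add: regular_elements_def)

lemma regular_cancel:
  assumes "s \<in> regular_elements R" "x \<in> carrier R" "y \<in> carrier R" "x \<otimes> s = y \<otimes> s"
  shows "x = y"
proof -
  have s: "s \<in> carrier R" using assms(1) by (rule regularD)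
  have "s \<otimes> (x \<ominus> y) = \<zero>"
    using assms(2-4) s by (simp add: m_comm minus_eq r_distr r_minus r_neg)
  then have "x \<ominus> y = \<zero>" using assms(1-3) by (simp add: regular_elements_def)
  moreover have "x = (x \<ominus> y) \<oplus> y" using assms(2,3) by (simp add: minus_eq a_assoc l_neg)
  ultimately show ?thesis using assms(3) by simp
qed

lemma regular_one: "\<one> \<in> regular_elements R"
  by (simp add: regular_elements_def)

lemma regular_mult:
  assumes "s \<in> regular_elements R" "v \<in> regular_elements R"
  shows "s \<otimes> v \<in> regular_elements R"
proof -
  have c: "s \<in> carrier R" "v \<in> carrier R" using assms by (auto intro: regularD)
  have "x = \<zero>" if x: "x \<in> carrier R" "(s \<otimes> v) \<otimes> x = \<zero>" for x
  proof -
    have "s \<otimes> (v \<otimes> x) = \<zero>" using x c by (simp add: m_assoc)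
    moreover have "v \<otimes> x \<in> carrier R" using x(1) c by simp
    ultimately have "v \<otimes> x = \<zero>" using assms(1) unfolding regular_elements_def by blast
    then show ?thesis using assms(2) x(1) unfolding regular_elements_def by blast
  qed
  then show ?thesis using c unfolding regular_elements_def by blast
qed

lemma fraction_self:
  assumes "x \<in> carrier R" "s \<in> regular_elements R"
  shows "(x, s) \<in> fraction R x s"
  using assms by (simp add: fraction_def)

lemma fraction_eq_iff:
  assumes "x \<in> carrier R" "s \<in> regular_elements R" "y \<in> carrier R" "v \<in> regular_elements R"
  shows "fraction R x s = fraction R y v \<longleftrightarrow> x \<otimes> v = y \<otimes> s"
proof
  assume "fraction R x s = fraction R y v"
  then have "(y, v) \<in> fraction R x s" using fraction_self assms by simp
  then show "x \<otimes> v = y \<otimes> s" by (simp add: fraction_def)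
next
  have sub: "fraction R x s \<subseteq> fraction R y v"
    if "x \<in> carrier R" "s \<in> regular_elements R" "y \<in> carrier R" "v \<in> regular_elements R"
      and e: "x \<otimes> v = y \<otimes> s" for x s y v
  proof clarify
    fix z w assume "(z, w) \<in> fraction R x s"
    then have zw: "z \<in> carrier R" "w \<in> regular_elements R" "x \<otimes> w = z \<otimes> s"
      by (auto simp: fraction_def)
    note c = that(1,3) zw(1) regularD[OF that(2)] regularD[OF that(4)] regularD[OF zw(2)]
    have "(y \<otimes> w) \<otimes> s = (y \<otimes> s) \<otimes> w" using c by (simp add: m_ac)
    also have "\<dots> = (x \<otimes> w) \<otimes> v" using c by (simp add: e[symmetric] m_ac)
    also have "\<dots> = (z \<otimes> v) \<otimes> s" using c by (simp add: zw(3) m_ac)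
    finally have "y \<otimes> w = z \<otimes> v"
      using regular_cancel[OF that(2)] c by simp
    then show "(z, w) \<in> fraction R y v" using zw by (simp add: fraction_def)
  qed
  assume "x \<otimes> v = y \<otimes> s"
  then show "fraction R x s = fraction R y v"
    using sub[of x s y v] sub[of y v x s] assms by auto
qed

lemma fraction_mult:
  assumes "x \<in> carrier R" "s \<in> regular_elements R" "y \<in> carrier R" "v \<in> regular_elements R"
  shows "fraction R x s \<otimes>\<^bsub>total_fraction_ring R\<^esub> fraction R y v
    = fraction R (x \<otimes> y) (s \<otimes> v)"
proof -
  have "fraction R (x' \<otimes> y') (s' \<otimes> v') = fraction R (x \<otimes> y) (s \<otimes> v)"
    if "(x', s') \<in> fraction R x s" "(y', v') \<in> fraction R y v" for x' s' y' v'
  proof -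
    have h: "x' \<in> carrier R" "s' \<in> regular_elements R" "x \<otimes> s' = x' \<otimes> s"
      "y' \<in> carrier R" "v' \<in> regular_elements R" "y \<otimes> v' = y' \<otimes> v"
      using that by (auto simp: fraction_def)
    note c = assms(1,3) h(1,4) assms(2,4)[THEN regularD] h(2,5)[THEN regularD]
    have "(x' \<otimes> y') \<otimes> (s \<otimes> v) = (x' \<otimes> s) \<otimes> (y' \<otimes> v)" using c by (simp add: m_ac)
    also have "\<dots> = (x \<otimes> s') \<otimes> (y \<otimes> v')" by (simp add: h)
    also have "\<dots> = (x \<otimes> y) \<otimes> (s' \<otimes> v')" using c by (simp add: m_ac)
    finally show ?thesis
      using c assms h by (subst fraction_eq_iff) (auto intro: regular_mult)
  qed
  then have "(\<Union>(x', s') \<in> fraction R x s. \<Union>(y', v') \<in> fraction R y v.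
      fraction R (x' \<otimes> y') (s' \<otimes> v'))
      = (\<Union>p \<in> fraction R x s. \<Union>q \<in> fraction R y v. fraction R (x \<otimes> y) (s \<otimes> v))"
    by (intro SUP_cong refl) (auto split: prod.split)
  also have "\<dots> = fraction R (x \<otimes> y) (s \<otimes> v)"
    using fraction_self[OF assms(1,2)] fraction_self[OF assms(3,4)] by blast
  finally show ?thesis by (simp add: total_fraction_ring_def)
qed

lemma fraction_add:
  assumes "x \<in> carrier R" "s \<in> regular_elements R" "y \<in> carrier R" "v \<in> regular_elements R"
  shows "fraction R x s \<oplus>\<^bsub>total_fraction_ring R\<^esub> fraction R y v
    = fraction R (x \<otimes> v \<oplus> y \<otimes> s) (s \<otimes> v)"
proof -
  have "fraction R (x' \<otimes> v' \<oplus> y' \<otimes> s') (s' \<otimes> v') = fraction R (x \<otimes> v \<oplus> y \<otimes> s) (s \<otimes> v)"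
    if "(x', s') \<in> fraction R x s" "(y', v') \<in> fraction R y v" for x' s' y' v'
  proof -
    have h: "x' \<in> carrier R" "s' \<in> regular_elements R" "x \<otimes> s' = x' \<otimes> s"
      "y' \<in> carrier R" "v' \<in> regular_elements R" "y \<otimes> v' = y' \<otimes> v"
      using that by (auto simp: fraction_def)
    note c = assms(1,3) h(1,4) assms(2,4)[THEN regularD] h(2,5)[THEN regularD]
    have "(x' \<otimes> v' \<oplus> y' \<otimes> s') \<otimes> (s \<otimes> v)
        = (x' \<otimes> v') \<otimes> (s \<otimes> v) \<oplus> (y' \<otimes> s') \<otimes> (s \<otimes> v)"
      using c by (intro l_distr) simp_all
    also have "\<dots> = (x' \<otimes> s) \<otimes> (v \<otimes> v') \<oplus> (y' \<otimes> v) \<otimes> (s \<otimes> s')"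
      using c by (simp add: m_ac)
    also have "\<dots> = (x \<otimes> s') \<otimes> (v \<otimes> v') \<oplus> (y \<otimes> v') \<otimes> (s \<otimes> s')" by (simp add: h)
    also have "\<dots> = (x \<otimes> v) \<otimes> (s' \<otimes> v') \<oplus> (y \<otimes> s) \<otimes> (s' \<otimes> v')"
      using c by (simp add: m_ac)
    also have "\<dots> = (x \<otimes> v \<oplus> y \<otimes> s) \<otimes> (s' \<otimes> v')"
      using c by (intro l_distr[symmetric]) simp_all
    finally show ?thesis
      using c assms h by (subst fraction_eq_iff) (auto intro: regular_mult)
  qed
  then have "(\<Union>(x', s') \<in> fraction R x s. \<Union>(y', v') \<in> fraction R y v.
      fraction R (x' \<otimes> v' \<oplus> y' \<otimes> s') (s' \<otimes> v'))
      = (\<Union>p \<in> fraction R x s. \<Union>q \<in> fraction R y v. fraction R (x \<otimes> v \<oplus> y \<otimes> s) (s \<otimes> v))"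
    by (intro SUP_cong refl) (auto split: prod.split)
  also have "\<dots> = fraction R (x \<otimes> v \<oplus> y \<otimes> s) (s \<otimes> v)"
    using fraction_self[OF assms(1,2)] fraction_self[OF assms(3,4)] by blast
  finally show ?thesis by (simp add: total_fraction_ring_def)
qed

end

section \<open>The Rees algebra and the quotients \<open>R(I)\<^sub>a\<^sub>,\<^sub>b\<close>\<close>

text \<open>The subring of \<^term>\<open>UP R\<close> of the polynomials whose coefficient of degree \<open>n\<close>
  lies in \<open>I\<^sup>n\<close>, where \<open>I\<^sup>0 = R\<close>; the ring operations are those of \<^term>\<open>UP R\<close>.
  Powers of ideals are powers in the monoid of ideals under the ideal product.\<close>

definition rees_algebra :: "('a, 'm) ring_scheme \<Rightarrow> 'a set \<Rightarrow> ('a, nat \<Rightarrow> 'a) up_ring" where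
  "rees_algebra R I =
     (UP R)\<lparr>carrier := {p \<in> carrier (UP R). \<forall>n::nat. coeff (UP R) p n \<in> I [^]\<^bsub>ideals_set R\<^esub> n}\<rparr>"

definition rees_modulus :: "('a, 'm) ring_scheme \<Rightarrow> 'a \<Rightarrow> 'a \<Rightarrow> nat \<Rightarrow> 'a" where
  "rees_modulus R a b =
     monom (UP R) \<one>\<^bsub>R\<^esub> 2 \<oplus>\<^bsub>UP R\<^esub> monom (UP R) a 1 \<oplus>\<^bsub>UP R\<^esub> monom (UP R) b 0"

definition rees_ideal ::
  "('a, 'm) ring_scheme \<Rightarrow> 'a set \<Rightarrow> 'a \<Rightarrow> 'a \<Rightarrow> (nat \<Rightarrow> 'a) set" where
  "rees_ideal R I a b = PIdl\<^bsub>UP R\<^esub> (rees_modulus R a b) \<inter> carrier (rees_algebra R I)"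

definition rees_quotient ::
  "('a, 'm) ring_scheme \<Rightarrow> 'a set \<Rightarrow> 'a \<Rightarrow> 'a \<Rightarrow> ((nat \<Rightarrow> 'a) set) ring" where
  "rees_quotient R I a b = rees_algebra R I Quot rees_ideal R I a b"

text \<open>The element \<open>r + it\<close> of \<open>R(I)\<^sub>a\<^sub>,\<^sub>b\<close>, for \<open>r \<in> R\<close> and \<open>i \<in> I\<close>.
  The embedding of \<open>R\<close> is the case \<open>i = 0\<close>.\<close>

definition rees_elem ::
  "('a, 'm) ring_scheme \<Rightarrow> 'a set \<Rightarrow> 'a \<Rightarrow> 'a \<Rightarrow> 'a \<Rightarrow> 'a \<Rightarrow> (nat \<Rightarrow> 'a) set" where
  "rees_elem R I a b r i =
     rees_ideal R I a b +>\<^bsub>rees_algebra R I\<^esub>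
       (monom (UP R) r 0 \<oplus>\<^bsub>UP R\<^esub> monom (UP R) i 1)"

end

theory Submission
  imports Defs "HOL-Algebra.Subrings"
begin

text \<open>Write \<open>f = t\<^sup>2 + at + b\<close>. The idea is to rationalise denominators. The other root of \<open>f\<close>
  is \<open>- a - t\<close>, so the element \<open>s + jt\<close> of \<open>R(I)\<^sub>a\<^sub>,\<^sub>b\<close> has the conjugate \<open>(s - aj) - jt\<close>, again
  with coefficients in \<open>R\<close> and \<open>I\<close>, and the product of the two is the norm
  \<open>u = s\<^sup>2 - asj + bj\<^sup>2\<close>, an element of \<open>R\<close> (lemma \<open>rees_elem_mult_conjugate\<close>). Expanding a
  fraction \<open>x / (s + jt)\<close> by the conjugate of its denominator turns the denominator into \<open>u\<close>.

  The expansion is legitimate because \<open>u\<close> inherits regularity from \<open>s + jt\<close>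
  (lemma \<open>regular_rees_norm\<close>): if \<open>ux = 0\<close> with \<open>x \<in> R\<close>, then cancelling the regular factor
  \<open>s + jt\<close> shows that \<open>x\<close> annihilates the conjugate. Comparing coefficients, \<open>jx = 0\<close> and
  \<open>(s - aj)x = 0\<close>, hence \<open>sx = 0\<close>, and \<open>x\<close> annihilates \<open>s + jt\<close> itself; so \<open>x = 0\<close>.
  Conversely an element regular in \<open>R\<close> stays regular in \<open>R(I)\<^sub>a\<^sub>,\<^sub>b\<close>, because it multiplies
  \<open>r + it\<close> coefficientwise (lemma \<open>regular_base\<close>).

  All of this rests on the description of the elements of \<open>R(I)\<^sub>a\<^sub>,\<^sub>b\<close> as the \<open>r + it\<close>, with unique
  \<open>r \<in> R\<close> and \<open>i \<in> I\<close>. Existence (\<open>rees_elem_surj\<close>) is division by the monic \<open>f\<close>, where it has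
  to be checked that the division does not leave the Rees algebra; uniqueness
  (\<open>rees_elem_eq_zero_iff\<close>) holds because a nonzero multiple of a monic quadratic
  polynomial has degree at least two.\<close>

section \<open>Powers of an ideal\<close>

context cring
begin

lemma ideal_power_is_ideal:
  assumes "ideal I R"
  shows "ideal (I [^]\<^bsub>ideals_set R\<^esub> (n::nat)) R"
proof -
  interpret M: comm_monoid "ideals_set R" by (rule ideals_set_is_comm_monoid)
  have "I \<in> carrier (ideals_set R)" using assms by (simp add: ideals_set_def)
  then have "I [^]\<^bsub>ideals_set R\<^esub> n \<in> carrier (ideals_set R)" by (rule M.nat_pow_closed)
  then show ?thesis by (simp add: ideals_set_def)
qed

lemma ideal_power_0: "I [^]\<^bsub>ideals_set R\<^esub> (0::nat) = carrier R"
  by (simp add: nat_pow_def) (simp add: ideals_set_def)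

lemma ideal_power_1:
  assumes "ideal I R"
  shows "I [^]\<^bsub>ideals_set R\<^esub> (1::nat) = I"
proof -
  interpret M: comm_monoid "ideals_set R" by (rule ideals_set_is_comm_monoid)
  show ?thesis using assms
    by (simp add: ideals_set_def ideal_prod_commute[OF oneideal] ideal_prod_one)
qed

lemma ideal_power_mult_mem:
  assumes "ideal I R" "x \<in> I [^]\<^bsub>ideals_set R\<^esub> (m::nat)" "y \<in> I [^]\<^bsub>ideals_set R\<^esub> (n::nat)"
  shows "x \<otimes> y \<in> I [^]\<^bsub>ideals_set R\<^esub> (m + n)"
proof -
  interpret M: comm_monoid "ideals_set R" by (rule ideals_set_is_comm_monoid)
  have I: "I \<in> carrier (ideals_set R)" using assms(1) by (simp add: ideals_set_def)
  have "I [^]\<^bsub>ideals_set R\<^esub> (m + n)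
      = (I [^]\<^bsub>ideals_set R\<^esub> m) \<cdot> (I [^]\<^bsub>ideals_set R\<^esub> n)"
    using M.nat_pow_mult[OF I, of m n] by (simp add: ideals_set_def)
  then show ?thesis using assms(2,3) by (simp add: ideal_prod.prod)
qed

lemma ideal_power_antimono:
  assumes "ideal I R" "(m::nat) \<le> n"
  shows "I [^]\<^bsub>ideals_set R\<^esub> n \<subseteq> I [^]\<^bsub>ideals_set R\<^esub> m"
proof -
  interpret M: comm_monoid "ideals_set R" by (rule ideals_set_is_comm_monoid)
  have I: "I \<in> carrier (ideals_set R)" using assms(1) by (simp add: ideals_set_def)
  have "I [^]\<^bsub>ideals_set R\<^esub> n
      = (I [^]\<^bsub>ideals_set R\<^esub> m) \<cdot> (I [^]\<^bsub>ideals_set R\<^esub> (n - m))"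
    using M.nat_pow_mult[OF I, of m "n - m"] assms(2) by (simp add: ideals_set_def)
  then show ?thesis
    using ideal_prod_inter[OF ideal_power_is_ideal[OF assms(1)] ideal_power_is_ideal[OF assms(1)]]
    by blast
qed

end

section \<open>The Rees algebra and its ideal\<close>

text \<open>Inside the locale, \<open>P\<close> is \<open>R[t]\<close>, \<open>A\<close> the Rees algebra, \<open>f\<close> the modulus
  \<open>t\<^sup>2 + at + b\<close>, \<open>J\<close> the contraction of \<open>fR[t]\<close> to \<open>A\<close>, and \<open>S = A/J\<close>.\<close>

locale rees = UP_cring R P + I: ideal I R
  for R (structure) and P (structure) and I +
  fixes a b
  assumes a_in [simp]: "a \<in> carrier R" and b_in [simp]: "b \<in> carrier R"
begin

abbreviation A where "A \<equiv> rees_algebra R I"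
abbreviation J where "J \<equiv> rees_ideal R I a b"
abbreviation S where "S \<equiv> rees_quotient R I a b"
abbreviation f where "f \<equiv> rees_modulus R a b"
abbreviation pow where "pow n \<equiv> I [^]\<^bsub>ideals_set R\<^esub> (n::nat)"

lemma mem_rees_algebra:
  "p \<in> carrier A \<longleftrightarrow> p \<in> carrier P \<and> (\<forall>n. coeff P p n \<in> pow n)"
  by (simp add: rees_algebra_def P_def)

lemma rees_algebra_eq: "A = P\<lparr>carrier := carrier A\<rparr>"
  by (simp add: rees_algebra_def P_def)

lemma pow_closed:
  shows pow_carrier: "x \<in> pow n \<Longrightarrow> x \<in> carrier R"
    and pow_zero: "\<zero> \<in> pow n"
    and pow_add: "x \<in> pow n \<Longrightarrow> y \<in> pow n \<Longrightarrow> x \<oplus> y \<in> pow n"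
    and pow_uminus: "x \<in> pow n \<Longrightarrow> \<ominus> x \<in> pow n"
    and pow_mult: "x \<in> pow n \<Longrightarrow> r \<in> carrier R \<Longrightarrow> x \<otimes> r \<in> pow n"
proof -
  interpret K: ideal "pow n" R by (rule R.ideal_power_is_ideal[OF I.ideal_axioms])
  show "x \<in> pow n \<Longrightarrow> x \<in> carrier R" by (rule K.Icarr)
  show "\<zero> \<in> pow n" by (rule K.zero_closed)
  show "x \<in> pow n \<Longrightarrow> y \<in> pow n \<Longrightarrow> x \<oplus> y \<in> pow n" by (rule K.a_closed)
  show "x \<in> pow n \<Longrightarrow> \<ominus> x \<in> pow n" by (rule K.a_inv_closed)
  show "x \<in> pow n \<Longrightarrow> r \<in> carrier R \<Longrightarrow> x \<otimes> r \<in> pow n" by (rule K.I_r_closed)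
qed

lemma monom_in_rees: "x \<in> pow n \<Longrightarrow> monom P x n \<in> carrier A"
  by (auto simp: mem_rees_algebra pow_carrier pow_zero)

text \<open>Closure under products is \<open>I\<^sup>i I\<^sup>n\<^sup>-\<^sup>i \<subseteq> I\<^sup>n\<close>, applied to each term of the
  convolution that gives the coefficient of degree \<open>n\<close>.\<close>

lemma rees_subcring: "subcring (carrier A) P"
proof (rule P.subcringI'[OF P.subringI])
  show "carrier A \<subseteq> carrier P" by (auto simp: mem_rees_algebra)
  show "\<one>\<^bsub>P\<^esub> \<in> carrier A"
    using pow_zero by (auto simp: mem_rees_algebra ideals_set_def)
  show "\<ominus>\<^bsub>P\<^esub> p \<in> carrier A" if "p \<in> carrier A" for p
    using that by (simp add: mem_rees_algebra pow_uminus)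
  show "p \<oplus>\<^bsub>P\<^esub> q \<in> carrier A" if "p \<in> carrier A" "q \<in> carrier A" for p q
    using that by (simp add: mem_rees_algebra pow_add)
  fix p q assume pq: "p \<in> carrier A" "q \<in> carrier A"
  have "coeff P (p \<otimes>\<^bsub>P\<^esub> q) n \<in> pow n" for n
  proof -
    interpret K: ideal "pow n" R by (rule R.ideal_power_is_ideal[OF I.ideal_axioms])
    have mem: "coeff P p i \<otimes> coeff P q (n - i) \<in> pow n" if "i \<le> n" for i
      using R.ideal_power_mult_mem[OF I.ideal_axioms, of _ i _ "n - i"] that pq
      by (simp add: mem_rees_algebra)
    \<comment> \<open>The partial sums are taken at the fixed degree \<open>n\<close>, so that every term stays in \<open>I\<^sup>n\<close>.\<close>
    have "(\<Oplus>i \<in> {..k}. coeff P p i \<otimes> coeff P q (n - i)) \<in> pow n" if "k \<le> n" for k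
      using that
    proof (induction k)
      case 0 then show ?case using mem[of 0] pq by (simp add: mem_rees_algebra)
    next
      case (Suc k)
      then show ?case using mem[of "Suc k"] pq
        by (simp add: mem_rees_algebra K.a_closed Pi_def)
    qed
    then show ?thesis using pq by (simp add: mem_rees_algebra)
  qed
  then show "p \<otimes>\<^bsub>P\<^esub> q \<in> carrier A" using pq by (simp add: mem_rees_algebra)
qed

lemma rees_cring: "cring A"
  using P.subcring_iff[of "carrier A"] rees_subcring rees_algebra_eq
  by (metis subcringE(1))

lemma modulus_eq:
  "f = monom P \<one> 2 \<oplus>\<^bsub>P\<^esub> monom P a 1 \<oplus>\<^bsub>P\<^esub> monom P b 0"
  by (simp add: rees_modulus_def P_def)

lemma modulus_closed [simp]: "f \<in> carrier P"
  by (simp add: modulus_eq)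

lemma mem_rees_ideal: "p \<in> J \<longleftrightarrow> p \<in> carrier A \<and> (\<exists>g \<in> carrier P. p = g \<otimes>\<^bsub>P\<^esub> f)"
  by (auto simp: rees_ideal_def cgenideal_def P_def)

lemma rees_ideal_is_ideal: "ideal J A"
proof -
  interpret A: cring A by (rule rees_cring)
  have "id \<in> ring_hom A P"
    by (rule ring_hom_memI)
      (auto simp: mem_rees_algebra, auto simp: rees_algebra_def P_def)
  then interpret h: ring_hom_ring A P id
    by (intro ring_hom_ringI2 A.ring_axioms P.ring_axioms)
  have "J = {p \<in> carrier A. id p \<in> PIdl\<^bsub>P\<^esub> f}"
    by (auto simp: rees_ideal_def P_def)
  then show ?thesis using h.ideal_vimage[OF P.cgenideal_ideal[OF modulus_closed]] by simp
qed

lemma quotient_cring: "cring S"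
  unfolding rees_quotient_def
  by (rule ideal.quotient_is_cring[OF rees_ideal_is_ideal rees_cring])

abbreviation cls where "cls p \<equiv> J +>\<^bsub>A\<^esub> p"

lemma cls_hom: "ring_hom_cring A S cls"
  unfolding rees_quotient_def
  by (rule ideal.rcos_ring_hom_cring[OF rees_ideal_is_ideal rees_cring])

text \<open>The operations of \<open>A\<close> are those of \<open>P\<close>; stating the homomorphism laws with the latter
  lets all polynomial identities be proved in \<open>P\<close>.\<close>

lemma cls_add:
  assumes "p \<in> carrier A" "q \<in> carrier A"
  shows "cls (p \<oplus>\<^bsub>P\<^esub> q) = cls p \<oplus>\<^bsub>S\<^esub> cls q"
proof -
  interpret h: ring_hom_cring A S cls by (rule cls_hom)
  have "p \<oplus>\<^bsub>P\<^esub> q = p \<oplus>\<^bsub>A\<^esub> q" by (subst rees_algebra_eq) simp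
  then show ?thesis using h.hom_add[OF assms] by simp
qed

lemma cls_mult:
  assumes "p \<in> carrier A" "q \<in> carrier A"
  shows "cls (p \<otimes>\<^bsub>P\<^esub> q) = cls p \<otimes>\<^bsub>S\<^esub> cls q"
proof -
  interpret h: ring_hom_cring A S cls by (rule cls_hom)
  have "p \<otimes>\<^bsub>P\<^esub> q = p \<otimes>\<^bsub>A\<^esub> q" by (subst rees_algebra_eq) simp
  then show ?thesis using h.hom_mult[OF assms] by simp
qed

lemma cls_eq_zero_iff:
  assumes "p \<in> carrier A"
  shows "cls p = \<zero>\<^bsub>S\<^esub> \<longleftrightarrow> p \<in> J"
proof -
  interpret K: ideal J A by (rule rees_ideal_is_ideal)
  have "\<zero>\<^bsub>S\<^esub> = J" by (simp add: rees_quotient_def FactRing_def)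
  then show ?thesis using K.a_rcos_self[OF assms] K.a_rcos_const by metis
qed

section \<open>Division by the modulus\<close>

abbreviation lin where "lin r i \<equiv> monom P r 0 \<oplus>\<^bsub>P\<^esub> monom P i 1"

abbreviation E where "E \<equiv> rees_elem R I a b"

lemma rees_elem_eq: "E r i = cls (lin r i)"
  by (simp add: rees_elem_def P_def)

lemma I_carrier [simp]: "i \<in> I \<Longrightarrow> i \<in> carrier R"
  by (rule I.Icarr)

lemma lin_closed: "r \<in> carrier R \<Longrightarrow> i \<in> I \<Longrightarrow> lin r i \<in> carrier A"
  using monom_in_rees[of r 0] monom_in_rees[of i 1] subcringE(7)[OF rees_subcring]
    R.ideal_power_0[of I] R.ideal_power_1[OF I.ideal_axioms] by simp

lemma rees_elem_closed: "r \<in> carrier R \<Longrightarrow> i \<in> I \<Longrightarrow> E r i \<in> carrier S"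
  using ring_hom_cring.axioms(1)[OF cls_hom] lin_closed
    ring_hom_closed[OF ideal.rcos_ring_hom[OF rees_ideal_is_ideal]]
  by (simp add: rees_elem_eq rees_quotient_def)

lemma monom_mult_modulus:
  assumes "c \<in> carrier R"
  shows "monom P c n \<otimes>\<^bsub>P\<^esub> f =
    monom P c (n + 2) \<oplus>\<^bsub>P\<^esub> monom P (c \<otimes> a) (n + 1) \<oplus>\<^bsub>P\<^esub> monom P (c \<otimes> b) n"
  using assms monom_mult[OF assms R.one_closed, of n 2]  monom_mult[OF assms a_in, of n 1]
    monom_mult[OF assms b_in, of n 0]
  by (simp add: modulus_eq P.r_distr)

text \<open>This is what keeps the division inside the Rees algebra: for \<open>c \<in> I\<^sup>n\<^sup>+\<^sup>2\<close> the lower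
  coefficients \<open>ca\<close> and \<open>cb\<close> of \<open>c t\<^sup>n f\<close> also lie in \<open>I\<^sup>n\<^sup>+\<^sup>2\<close>, which is contained in
  \<open>I\<^sup>n\<^sup>+\<^sup>1\<close> and \<open>I\<^sup>n\<close>.\<close>

lemma monom_mult_modulus_in_rees_ideal:
  assumes "c \<in> pow (n + 2)"
  shows "monom P c n \<otimes>\<^bsub>P\<^esub> f \<in> J"
proof -
  have c: "c \<in> carrier R" by (rule pow_carrier[OF assms])
  have "c \<in> pow (n + 1)" "c \<in> pow n"
    using assms R.ideal_power_antimono[OF I.ideal_axioms, of "n + 1" "n + 2"]
      R.ideal_power_antimono[OF I.ideal_axioms, of n "n + 2"] by auto
  then have "monom P c (n + 2) \<in> carrier A" "monom P (c \<otimes> a) (n + 1) \<in> carrier A"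
    "monom P (c \<otimes> b) n \<in> carrier A"
    using assms by (auto intro: monom_in_rees[OF pow_mult] monom_in_rees)
  then have "monom P c n \<otimes>\<^bsub>P\<^esub> f \<in> carrier A"
    unfolding monom_mult_modulus[OF c] by (intro subcringE(7)[OF rees_subcring])
  then show ?thesis using c by (auto simp: mem_rees_ideal)
qed

text \<open>Division with remainder by the monic \<open>f\<close>: subtracting \<open>c t\<^sup>n f \<in> J\<close>, for \<open>c\<close> the coefficient
  of degree \<open>n + 2\<close>, kills that coefficient without changing the class.\<close>

lemma cls_eq_rees_elem_of_bound:
  assumes "p \<in> carrier A" "\<And>m. m \<ge> n + 2 \<Longrightarrow> coeff P p m = \<zero>"
  shows "\<exists>r \<in> carrier R. \<exists>i \<in> I. cls p = E r i"
  using assms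
proof (induction n arbitrary: p)
  case 0
  let ?r = "coeff P p 0" and ?i = "coeff P p 1"
  have p: "p \<in> carrier P" using 0 by (simp add: mem_rees_algebra)
  have i: "?i \<in> I"
    using 0(1) R.ideal_power_1[OF I.ideal_axioms] unfolding mem_rees_algebra by blast
  have "p = lin ?r ?i"
  proof (rule up_eqI)
    show "coeff P p m = coeff P (lin ?r ?i) m" for m
      using p 0(2)[of m] by (cases "m = 0 \<or> m = 1") auto
  qed (use p in simp_all)
  then have "cls p = E ?r ?i" unfolding rees_elem_eq by (rule arg_cong)
  then show ?case using p i coeff_closed by blast
next
  case (Suc n)
  interpret S: cring S by (rule quotient_cring)
  interpret h: ring_hom_cring A S cls by (rule cls_hom)
  define c where "c = coeff P p (n + 2)"
  have p: "p \<in> carrier P" using Suc by (simp add: mem_rees_algebra)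
  have c: "c \<in> pow (n + 2)" using Suc(2) unfolding c_def mem_rees_algebra by blast
  then have cR: "c \<in> carrier R" by (rule pow_carrier)
  let ?g = "monom P (\<ominus> c) n \<otimes>\<^bsub>P\<^esub> f"
  have gJ: "?g \<in> J" by (intro monom_mult_modulus_in_rees_ideal pow_uminus c)
  then have gA: "?g \<in> carrier A" by (simp add: mem_rees_ideal)
  have "p \<oplus>\<^bsub>P\<^esub> ?g \<in> carrier A" using subcringE(7)[OF rees_subcring Suc(2) gA] .
  moreover have "coeff P (p \<oplus>\<^bsub>P\<^esub> ?g) m = \<zero>" if "m \<ge> n + 2" for m
  proof (cases "m = n + 2")
    case True
    then show ?thesis using p cR
      by (simp add: monom_mult_modulus c_def R.r_neg del: coeff_mult monom_a_inv)
  next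
    case False
    then show ?thesis using p cR that Suc(3)[of m]
      by (simp add: monom_mult_modulus del: coeff_mult monom_a_inv)
  qed
  ultimately obtain r i where "r \<in> carrier R" "i \<in> I" "cls (p \<oplus>\<^bsub>P\<^esub> ?g) = E r i"
    using Suc.IH by blast
  moreover have "cls (p \<oplus>\<^bsub>P\<^esub> ?g) = cls p"
    using cls_add[OF Suc(2) gA] gJ cls_eq_zero_iff[OF gA] h.hom_closed[OF Suc(2)] by simp
  ultimately show ?case by auto
qed

lemma rees_elem_surj:
  assumes "x \<in> carrier S"
  obtains r i where "r \<in> carrier R" "i \<in> I" "x = E r i"
proof -
  obtain p where p: "p \<in> carrier A" "x = cls p"
    using assms by (auto simp: rees_quotient_def FactRing_simps)
  have "coeff P p m = \<zero>" if "m \<ge> deg R p + 2" for m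
    using deg_aboveD[of p m] p(1) that by (simp add: mem_rees_algebra)
  then show thesis using cls_eq_rees_elem_of_bound[OF p(1)] p(2) that by metis
qed

text \<open>A multiple \<open>gf\<close> with \<open>g\<close> of degree \<open>d\<close> has, \<open>f\<close> being monic, the leading coefficient of
  \<open>g\<close> as its coefficient of degree \<open>d + 2\<close>; if \<open>gf\<close> is linear this forces \<open>g = 0\<close>.\<close>

lemma rees_elem_eq_zero_iff:
  assumes "r \<in> carrier R" "i \<in> I"
  shows "E r i = \<zero>\<^bsub>S\<^esub> \<longleftrightarrow> r = \<zero> \<and> i = \<zero>"
proof
  assume "r = \<zero> \<and> i = \<zero>"
  then have "lin r i = \<zero>\<^bsub>P\<^esub> \<otimes>\<^bsub>P\<^esub> f" by simp
  then have "lin r i \<in> J" using lin_closed[OF assms] unfolding mem_rees_ideal by blast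
  then show "E r i = \<zero>\<^bsub>S\<^esub>"
    using cls_eq_zero_iff[OF lin_closed[OF assms]] by (simp add: rees_elem_eq)
next
  assume "E r i = \<zero>\<^bsub>S\<^esub>"
  then obtain g where g: "g \<in> carrier P" and e: "lin r i = g \<otimes>\<^bsub>P\<^esub> f"
    using cls_eq_zero_iff[OF lin_closed[OF assms]] by (auto simp: rees_elem_eq mem_rees_ideal)
  have "g = \<zero>\<^bsub>P\<^esub>"
  proof (rule ccontr)
    assume ng: "g \<noteq> \<zero>\<^bsub>P\<^esub>"
    let ?d = "deg R g"
    have "g \<otimes>\<^bsub>P\<^esub> f = monom P \<one> 2 \<otimes>\<^bsub>P\<^esub> g \<oplus>\<^bsub>P\<^esub> monom P a 1 \<otimes>\<^bsub>P\<^esub> g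
        \<oplus>\<^bsub>P\<^esub> monom P b 0 \<otimes>\<^bsub>P\<^esub> g"
      using g by (simp add: modulus_eq P.r_distr P.m_comm)
    then have "coeff P (g \<otimes>\<^bsub>P\<^esub> f) (?d + 2)
        = coeff P g ?d \<oplus> a \<otimes> coeff P g (?d + 1) \<oplus> b \<otimes> coeff P g (?d + 2)"
      using g coeff_monom_mult[OF R.one_closed g, of 2 ?d]
        coeff_monom_mult[OF a_in g, of 1 "?d + 1"] coeff_monom_mult[OF b_in g, of 0 "?d + 2"]
      by (simp del: coeff_mult add: add.commute)
    also have "\<dots> = coeff P g ?d" using g by (simp add: deg_aboveD)
    finally have "coeff P (lin r i) (?d + 2) = coeff P g ?d" by (simp only: e)
    then have "coeff P g ?d = \<zero>" using assms by simp
    then show False using lcoeff_nonzero[OF ng g] by simp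
  qed
  then have "lin r i = \<zero>\<^bsub>P\<^esub>" using e by simp
  then have "coeff P (lin r i) n = \<zero>" for n by simp
  from this[of 0] this[of 1] show "r = \<zero> \<and> i = \<zero>" using assms by simp
qed

section \<open>Conjugate and norm\<close>

text \<open>Substitute \<open>t\<^sup>2 = f - at - b\<close> into the term \<open>ij t\<^sup>2\<close>.\<close>

lemma lin_mult_lin:
  assumes "r \<in> carrier R" "i \<in> carrier R" "s \<in> carrier R" "j \<in> carrier R"
  shows "lin r i \<otimes>\<^bsub>P\<^esub> lin s j =
    lin (r \<otimes> s \<ominus> b \<otimes> (i \<otimes> j)) (r \<otimes> j \<oplus> i \<otimes> s \<ominus> a \<otimes> (i \<otimes> j))
      \<oplus>\<^bsub>P\<^esub> monom P (i \<otimes> j) 0 \<otimes>\<^bsub>P\<^esub> f"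
proof -
  have "lin r i \<otimes>\<^bsub>P\<^esub> lin s j = monom P (r \<otimes> s) 0 \<oplus>\<^bsub>P\<^esub> monom P (i \<otimes> s) 1
      \<oplus>\<^bsub>P\<^esub> (monom P (r \<otimes> j) 1 \<oplus>\<^bsub>P\<^esub> monom P (i \<otimes> j) 2)"
    using assms monom_mult[of r s 0 0] monom_mult[of i s 1 0] monom_mult[of r j 0 1]
      monom_mult[of i j 1 1]
    by (simp add: P.l_distr P.r_distr numeral_2_eq_2)
  also have "\<dots> = lin (r \<otimes> s \<ominus> b \<otimes> (i \<otimes> j)) (r \<otimes> j \<oplus> i \<otimes> s \<ominus> a \<otimes> (i \<otimes> j))
      \<oplus>\<^bsub>P\<^esub> monom P (i \<otimes> j) 0 \<otimes>\<^bsub>P\<^esub> f"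
  proof (rule up_eqI)
    fix n :: nat
    have e: "r \<otimes> s \<ominus> b \<otimes> (i \<otimes> j) \<oplus> i \<otimes> j \<otimes> b = r \<otimes> s"
      "r \<otimes> j \<oplus> i \<otimes> s \<ominus> a \<otimes> (i \<otimes> j) \<oplus> i \<otimes> j \<otimes> a = i \<otimes> s \<oplus> r \<otimes> j"
      using assms a_in b_in by algebra+
    consider "n = 0" | "n = 1" | "n = 2" | "n > 2" by linarith
    then show "coeff P (monom P (r \<otimes> s) 0 \<oplus>\<^bsub>P\<^esub> monom P (i \<otimes> s) 1
          \<oplus>\<^bsub>P\<^esub> (monom P (r \<otimes> j) 1 \<oplus>\<^bsub>P\<^esub> monom P (i \<otimes> j) 2)) n =
        coeff P (lin (r \<otimes> s \<ominus> b \<otimes> (i \<otimes> j)) (r \<otimes> j \<oplus> i \<otimes> s \<ominus> a \<otimes> (i \<otimes> j))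
          \<oplus>\<^bsub>P\<^esub> monom P (i \<otimes> j) 0 \<otimes>\<^bsub>P\<^esub> f) n"
      using assms e by cases (simp_all add: monom_mult_modulus)
  qed (use assms in simp_all)
  finally show ?thesis .
qed

lemma rees_elem_mult:
  assumes "r \<in> carrier R" "i \<in> I" "s \<in> carrier R" "j \<in> I"
  shows "E r i \<otimes>\<^bsub>S\<^esub> E s j =
    E (r \<otimes> s \<ominus> b \<otimes> (i \<otimes> j)) (r \<otimes> j \<oplus> i \<otimes> s \<ominus> a \<otimes> (i \<otimes> j))"
    and "r \<otimes> j \<oplus> i \<otimes> s \<ominus> a \<otimes> (i \<otimes> j) \<in> I"
proof -
  interpret S: cring S by (rule quotient_cring)
  let ?r = "r \<otimes> s \<ominus> b \<otimes> (i \<otimes> j)" and ?i = "r \<otimes> j \<oplus> i \<otimes> s \<ominus> a \<otimes> (i \<otimes> j)"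
  show i: "?i \<in> I"
    unfolding R.minus_eq
    by (intro I.a_closed I.a_inv_closed I.I_l_closed I.I_r_closed assms a_in I_carrier)
  have ij: "i \<in> carrier R" "j \<in> carrier R" using assms by simp_all
  have r: "?r \<in> carrier R" by (intro R.minus_closed R.m_closed b_in ij assms)
  let ?g = "monom P (i \<otimes> j) 0 \<otimes>\<^bsub>P\<^esub> f"
  \<comment> \<open>The correction \<open>ij f\<close> vanishes in \<open>S\<close>: since \<open>ij \<in> I\<^sup>2\<close>, it lies in the Rees algebra.\<close>
  have "i \<in> pow 1" "j \<in> pow 1"
    using assms R.ideal_power_1[OF I.ideal_axioms] by simp_all
  then have "i \<otimes> j \<in> pow (0 + 2)"
    using R.ideal_power_mult_mem[OF I.ideal_axioms, of i 1 j 1] by (simp add: numeral_2_eq_2)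
  then have gJ: "?g \<in> J" by (rule monom_mult_modulus_in_rees_ideal)
  then have gA: "?g \<in> carrier A" by (simp add: mem_rees_ideal)
  have "E r i \<otimes>\<^bsub>S\<^esub> E s j = cls (lin r i \<otimes>\<^bsub>P\<^esub> lin s j)"
    unfolding rees_elem_eq by (intro cls_mult[symmetric] lin_closed assms)
  also have "\<dots> = cls (lin ?r ?i \<oplus>\<^bsub>P\<^esub> ?g)"
    by (intro arg_cong[of _ _ cls] lin_mult_lin assms ij)
  also have "\<dots> = E ?r ?i \<oplus>\<^bsub>S\<^esub> cls ?g"
    unfolding rees_elem_eq by (intro cls_add lin_closed r i gA)
  also have "\<dots> = E ?r ?i \<oplus>\<^bsub>S\<^esub> \<zero>\<^bsub>S\<^esub>"
    by (subst cls_eq_zero_iff[OF gA, THEN iffD2, OF gJ]) (rule refl)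
  also have "\<dots> = E ?r ?i" by (intro S.r_zero rees_elem_closed r i)
  finally show "E r i \<otimes>\<^bsub>S\<^esub> E s j = E ?r ?i" .
qed

lemma rees_elem_mult_base:
  assumes "r \<in> carrier R" "i \<in> I" "u \<in> carrier R"
  shows "E r i \<otimes>\<^bsub>S\<^esub> E u \<zero> = E (r \<otimes> u) (i \<otimes> u)"
proof -
  have "r \<otimes> u \<ominus> b \<otimes> (i \<otimes> \<zero>) = r \<otimes> u"
    and "r \<otimes> \<zero> \<oplus> i \<otimes> u \<ominus> a \<otimes> (i \<otimes> \<zero>) = i \<otimes> u"
    using assms(1,3) I_carrier[OF assms(2)] a_in b_in by algebra+
  then show ?thesis using rees_elem_mult(1)[OF assms I.zero_closed] by simp
qed

lemma regular_base:
  assumes "u \<in> regular_elements R"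
  shows "E u \<zero> \<in> regular_elements S"
  unfolding regular_elements_def
proof (intro CollectI conjI ballI impI)
  interpret S: cring S by (rule quotient_cring)
  have u: "u \<in> carrier R" by (rule R.regularD[OF assms])
  show E: "E u \<zero> \<in> carrier S" by (intro rees_elem_closed u I.zero_closed)
  fix x assume x: "x \<in> carrier S" and z: "E u \<zero> \<otimes>\<^bsub>S\<^esub> x = \<zero>\<^bsub>S\<^esub>"
  obtain r i where ri: "r \<in> carrier R" "i \<in> I" "x = E r i" using x by (rule rees_elem_surj)
  have "E (r \<otimes> u) (i \<otimes> u) = \<zero>\<^bsub>S\<^esub>"
    using z x E ri rees_elem_mult_base[OF ri(1,2) u] by (simp add: S.m_comm)
  then have "r \<otimes> u = \<zero>" "i \<otimes> u = \<zero>"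
    using rees_elem_eq_zero_iff[of "r \<otimes> u" "i \<otimes> u"] ri u by (simp_all add: I.I_r_closed)
  then have "r = \<zero>" "i = \<zero>"
    using R.regular_cancel[OF assms, of _ \<zero>] ri u by simp_all
  then show "x = \<zero>\<^bsub>S\<^esub>" using ri rees_elem_eq_zero_iff by simp
qed

text \<open>The product of the values of \<open>s + jt\<close> at the two roots \<open>t\<close> and \<open>- a - t\<close> of \<open>f\<close>.\<close>

definition rees_norm where "rees_norm s j = s \<otimes> (s \<ominus> a \<otimes> j) \<oplus> b \<otimes> (j \<otimes> j)"

lemma rees_norm_closed: "s \<in> carrier R \<Longrightarrow> j \<in> I \<Longrightarrow> rees_norm s j \<in> carrier R"
  by (simp add: rees_norm_def)

lemma rees_elem_mult_conjugate:
  assumes "s \<in> carrier R" "j \<in> I"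
  shows "E s j \<otimes>\<^bsub>S\<^esub> E (s \<ominus> a \<otimes> j) (\<ominus> j) = E (rees_norm s j) \<zero>"
proof -
  have j: "j \<in> carrier R" using assms by simp
  have 1: "s \<otimes> (s \<ominus> a \<otimes> j) \<ominus> b \<otimes> (j \<otimes> \<ominus> j) = rees_norm s j"
    unfolding rees_norm_def using assms(1) j a_in b_in by algebra
  have 2: "s \<otimes> \<ominus> j \<oplus> j \<otimes> (s \<ominus> a \<otimes> j) \<ominus> a \<otimes> (j \<otimes> \<ominus> j) = \<zero>"
    using assms(1) j a_in b_in by algebra
  show ?thesis
    using rees_elem_mult(1)[of s j "s \<ominus> a \<otimes> j" "\<ominus> j"] assms
    by (simp add: 1 2 I.a_inv_closed)
qed

text \<open>An annihilator \<open>x \<in> R\<close> of the norm is transferred, by cancelling \<open>s + jt\<close>, to the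
  conjugate. The coefficients of the conjugate generate the same ideal as \<open>s\<close> and \<open>j\<close>, so
  \<open>x\<close> also annihilates \<open>s + jt\<close>.\<close>

lemma regular_rees_norm:
  assumes s: "s \<in> carrier R" and j: "j \<in> I" and reg: "E s j \<in> regular_elements S"
  shows "rees_norm s j \<in> regular_elements R"
  unfolding regular_elements_def
proof (intro CollectI conjI ballI impI)
  interpret S: cring S by (rule quotient_cring)
  show u: "rees_norm s j \<in> carrier R" by (rule rees_norm_closed[OF s j])
  fix x assume x: "x \<in> carrier R" and z: "rees_norm s j \<otimes> x = \<zero>"
  have regD: "y = \<zero>\<^bsub>S\<^esub>" if "y \<in> carrier S" "E s j \<otimes>\<^bsub>S\<^esub> y = \<zero>\<^bsub>S\<^esub>" for y
    using reg that by (simp add: regular_elements_def)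
  let ?c = "s \<ominus> a \<otimes> j"
  have jR: "j \<in> carrier R" using j by simp
  have c: "?c \<in> carrier R" "\<ominus> j \<in> I" using s j by (simp_all add: I.a_inv_closed)
  have cl: "E s j \<in> carrier S" "E ?c (\<ominus> j) \<in> carrier S" "E x \<zero> \<in> carrier S"
    by (intro rees_elem_closed s j c x I.zero_closed)+
  have "E s j \<otimes>\<^bsub>S\<^esub> (E ?c (\<ominus> j) \<otimes>\<^bsub>S\<^esub> E x \<zero>) = E (rees_norm s j) \<zero> \<otimes>\<^bsub>S\<^esub> E x \<zero>"
    unfolding rees_elem_mult_conjugate[OF s j, symmetric] by (intro S.m_assoc[symmetric] cl)
  also have "\<dots> = E (rees_norm s j \<otimes> x) (\<zero> \<otimes> x)"
    by (intro rees_elem_mult_base u I.zero_closed x)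
  also have "\<dots> = \<zero>\<^bsub>S\<^esub>" using rees_elem_eq_zero_iff[of \<zero> \<zero>] x z by simp
  finally have "E ?c (\<ominus> j) \<otimes>\<^bsub>S\<^esub> E x \<zero> = \<zero>\<^bsub>S\<^esub>"
    by (rule regD[OF S.m_closed[OF cl(2,3)]])
  then have "E (?c \<otimes> x) (\<ominus> j \<otimes> x) = \<zero>\<^bsub>S\<^esub>"
    using rees_elem_mult_base[OF c x] by simp
  then have k: "?c \<otimes> x = \<zero>" "\<ominus> j \<otimes> x = \<zero>"
    using rees_elem_eq_zero_iff[of "?c \<otimes> x" "\<ominus> j \<otimes> x"] c x by (simp_all add: I.I_r_closed)
  have "j \<otimes> x = \<ominus> (\<ominus> j \<otimes> x)" using jR x by algebra
  then have jx: "j \<otimes> x = \<zero>" using k by simp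
  have "s \<otimes> x = ?c \<otimes> x \<oplus> a \<otimes> (j \<otimes> x)" using s jR x a_in by algebra
  then have "s \<otimes> x = \<zero>" using k jx by simp
  then have "E s j \<otimes>\<^bsub>S\<^esub> E x \<zero> = \<zero>\<^bsub>S\<^esub>"
    using rees_elem_mult_base[OF s j x] rees_elem_eq_zero_iff[of \<zero> \<zero>] jx by simp
  then have "E x \<zero> = \<zero>\<^bsub>S\<^esub>" by (rule regD[OF cl(3)])
  then show "x = \<zero>" using rees_elem_eq_zero_iff[of x \<zero>] x by simp
qed

lemma fraction_eq_regular_base_denominator:
  assumes x: "x \<in> carrier S" and s: "y \<in> regular_elements S"
  shows "\<exists>r \<in> carrier R. \<exists>i \<in> I. \<exists>u \<in> regular_elements R.
    E u \<zero> \<in> regular_elements S \<and> fraction S x y = fraction S (E r i) (E u \<zero>)"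
proof -
  interpret S: cring S by (rule quotient_cring)
  obtain s j where sj: "s \<in> carrier R" "j \<in> I" "y = E s j"
    using S.regularD[OF s] by (rule rees_elem_surj)
  let ?c = "E (s \<ominus> a \<otimes> j) (\<ominus> j)"
  have c: "?c \<in> carrier S" using sj by (intro rees_elem_closed) (simp_all add: I.a_inv_closed)
  have y: "y \<in> carrier S" by (rule S.regularD[OF s])
  obtain r i where ri: "r \<in> carrier R" "i \<in> I" "x \<otimes>\<^bsub>S\<^esub> ?c = E r i"
    using S.m_closed[OF x c] by (rule rees_elem_surj)
  have u: "rees_norm s j \<in> regular_elements R" using regular_rees_norm sj s by simp
  have "E (rees_norm s j) \<zero> = y \<otimes>\<^bsub>S\<^esub> ?c"
    using rees_elem_mult_conjugate[OF sj(1,2)] by (simp only: sj(3))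
  then have "x \<otimes>\<^bsub>S\<^esub> E (rees_norm s j) \<zero> = x \<otimes>\<^bsub>S\<^esub> (?c \<otimes>\<^bsub>S\<^esub> y)"
    by (simp only: S.m_comm[OF y c])
  also have "\<dots> = E r i \<otimes>\<^bsub>S\<^esub> y"
    unfolding ri(3)[symmetric] by (rule S.m_assoc[OF x c y, symmetric])
  finally have "fraction S x y = fraction S (E r i) (E (rees_norm s j) \<zero>)"
    using S.fraction_eq_iff[OF x s rees_elem_closed[OF ri(1,2)] regular_base[OF u]] by simp
  then show ?thesis using ri u regular_base[OF u] by blast
qed

end

section \<open>The total ring of fractions\<close>

theorem proposition1p7:
  fixes R :: "('a, 'm) ring_scheme" and I :: "'a set" and a b :: 'a
  assumes "cring R" and "ideal I R" and "I \<noteq> carrier R"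
    and "a \<in> carrier R" and "b \<in> carrier R"
  shows "\<forall>q \<in> carrier (total_fraction_ring (rees_quotient R I a b)).
    \<exists>r \<in> carrier R. \<exists>i \<in> I. \<exists>u \<in> regular_elements R.
      rees_elem R I a b u \<zero>\<^bsub>R\<^esub> \<in> regular_elements (rees_quotient R I a b) \<and>
      q = fraction (rees_quotient R I a b) (rees_elem R I a b r i) (rees_elem R I a b u \<zero>\<^bsub>R\<^esub>)"
proof
  fix q assume "q \<in> carrier (total_fraction_ring (rees_quotient R I a b))"
  then obtain x y where q: "q = fraction (rees_quotient R I a b) x y"
    and xy: "x \<in> carrier (rees_quotient R I a b)" "y \<in> regular_elements (rees_quotient R I a b)"
    unfolding total_fraction_ring_def by auto
  interpret rees R "UP R" I a b
    using assms by (intro rees.intro rees_axioms.intro UP_cring.intro)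
  show "\<exists>r \<in> carrier R. \<exists>i \<in> I. \<exists>u \<in> regular_elements R.
      rees_elem R I a b u \<zero>\<^bsub>R\<^esub> \<in> regular_elements (rees_quotient R I a b) \<and>
      q = fraction (rees_quotient R I a b) (rees_elem R I a b r i) (rees_elem R I a b u \<zero>\<^bsub>R\<^esub>)"
    using fraction_eq_regular_base_denominator[OF xy] q by simp
qed

end
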